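(* Let $\boldsymbol A(t),\boldsymbol B(t)\in\mathbb R^{d\times d}$ be factor matrices, trained by gradient flow on the pre-training observation set $\Omega_{\rm pre}^{(d)}$ for $0\le t\le T_1$ and then, continuing from $(\boldsymbol A(T_1),\boldsymbol B(T_1))$, by gradient flow on the post-training observation set $\Omega_{\rm post}^{(d)}$ for $t\ge T_1$. Suppose they are balanced at $t=0$: $\boldsymbol A(0)^\top\boldsymbol A(0)=\boldsymbol B(0)\boldsymbol B(0)^\top$. Let $f(\boldsymbol A,\boldsymbol B)=\big((\boldsymbol A\boldsymbol B)_{ij}\big)_{(i,j)\in\Omega_{\rm post}^{(d)}}$ be the vector of model predictions on $\Omega_{\rm post}^{(d)}$, and let $\sigma_{\max}$ and $\sigma_{\min}$ be the maximum and minimum singular values of the Jacobian of $f$ (with respect to the vectorized entries of $\boldsymbol A$ and $\boldsymbol B$) evaluated at the pre-trained state $(\boldsymbol A(T_1),\boldsymbol B(T_1))$. If $$\ell\big(\boldsymbol W_{\boldsymbol A,\boldsymbol B}(T_1);\Omega_{\rm post}^{(d)}\big)\le\frac{\sigma_{\min}^6}{1152\,d\,\sigma_{\max}^2},$$ then for all $t\ge T_1$, $$\ell\big(\boldsymbol W_{\boldsymbol A,\boldsymbol B}(t);\Omega_{\rm post}^{(d)}\big)\le\ell\big(\boldsymbol W_{\boldsymbol A,\boldsymbol B}(T_1);\Omega_{\rm post}^{(d)}\big)\exp\left(-\tfrac12\sigma_{\min}^2(t-T_1)\right).$$ Consequently, for all $t\ge T_1$ the stable rank of $\boldsymbol A(t)$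 (which is equal to that of $\boldsymbol B(t)$) satisfies $$\mathrm{srank}\big(\boldsymbol A(t)\big)\ge\left(\frac{\|\boldsymbol A(T_1)\|_F-\frac{\sigma_{\min}}{4\sqrt{2d}}}{\|\boldsymbol A(T_1)\|_2+\frac{\sigma_{\min}}{4\sqrt{2d}}}\right)^2.$$
   Context: $\boldsymbol W_{\boldsymbol A,\boldsymbol B}(t)=\boldsymbol A(t)\boldsymbol B(t)$. For a ground-truth matrix $\boldsymbol W^*=(w_{ij}^* )\in\mathbb R^{d\times d}$ and $\Omega\subseteq[d]\times[d]$, $\ell(\boldsymbol W;\Omega)=\frac12\sum_{(i,j)\in\Omega}(w_{ij}-w_{ij}^* )^2$; gradient flow on $\Omega$ means $\dot{\boldsymbol A}=-\partial_{\boldsymbol A}\ell(\boldsymbol A\boldsymbol B;\Omega)$, $\dot{\boldsymbol B}=-\partial_{\boldsymbol B}\ell(\boldsymbol A\boldsymbol B;\Omega)$. $\Omega_{\rm pre}^{(d)}=\{(i,i):i\in[d]\}$, and $\Omega_{\rm post}^{(d)}\supseteq\Omega_{\rm pre}^{(d)}$ is obtained by adding off-diagonal observed positions. The Jacobian is the $N\times2d^2$ matrix with $N=|\Omega_{\rm post}^{(d)}|\le d^2$; its minimum singular value is the smallest of its $N$ singular values. The stable rank is $\mathrm{srank}(\boldsymbol M)=\|\boldsymbol M\|_F^2/\|\boldsymbol M\|_2^2$ (Frobenius and spectral norms). *)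

theory Defs
  imports "HOL-Analysis.Analysis"
begin

definition loss :: "real^'n^'n \<Rightarrow> real^'n^'n \<Rightarrow> ('n \<times> 'n) set \<Rightarrow> real" where
  "loss Wstar W \<Omega> = 1/2 * (\<Sum>(i,j)\<in>\<Omega>. (W $ i $ j - Wstar $ i $ j)\<^sup>2)"

text \<open>
  The inner product on matrices is the entrywise one, so the gradients \<open>GA\<close> and \<open>GB\<close>
  below are the matrices of partial derivatives of the loss. At an end point of \<open>I\<close>
  the time derivatives are one-sided.
\<close>
definition gradient_flow_on ::
  "real^'n^'n \<Rightarrow> ('n \<times> 'n) set \<Rightarrow> real set \<Rightarrow> (real \<Rightarrow> real^'n^'n) \<Rightarrow> (real \<Rightarrow> real^'n^'n) \<Rightarrow> bool"
where
  "gradient_flow_on Wstar \<Omega> I A B \<longleftrightarrow>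
     (\<forall>t\<in>I. \<exists>GA GB.
        GDERIV (\<lambda>X. loss Wstar (X ** B t) \<Omega>) (A t) :> GA \<and>
        GDERIV (\<lambda>Y. loss Wstar (A t ** Y) \<Omega>) (B t) :> GB \<and>
        (A has_vector_derivative - GA) (at t within I) \<and>
        (B has_vector_derivative - GB) (at t within I))"

definition Omega_pre :: "('n \<times> 'n) set" where
  "Omega_pre = {(i, i) | i. True}"

text \<open>
  Real matrices with rows indexed by a finite set \<open>R\<close> and columns by a finite set \<open>C\<close>,
  where \<open>card R \<le> card C\<close>: the \<open>card R\<close> singular values of \<open>M\<close> are the square roots
  of the eigenvalues of \<open>M M\<^sup>T\<close>. Multiplicities are dropped, since only the largest and
  the smallest singular value matter.
\<close>
definition singular_values :: "'r set \<Rightarrow> 'c set \<Rightarrow> ('r \<Rightarrow> 'c \<Rightarrow> real) \<Rightarrow> real set" where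
  "singular_values R C M =
     {sqrt \<mu> | \<mu>. \<exists>v. (\<exists>r\<in>R. v r \<noteq> 0) \<and>
        (\<forall>r\<in>R. (\<Sum>r'\<in>R. (\<Sum>c\<in>C. M r c * M r' c) * v r') = \<mu> * v r)}"

definition prediction :: "'n \<times> 'n \<Rightarrow> (real^'n^'n) \<times> (real^'n^'n) \<Rightarrow> real" where
  "prediction ij AB = (fst AB ** snd AB) $ fst ij $ snd ij"

text \<open>
  The columns are indexed by \<open>Basis\<close>, whose \<open>2 * CARD('n)\<^sup>2\<close> elements are the coordinate
  directions of the individual entries of the two factors.
\<close>
definition prediction_jacobian ::
  "(real^'n^'n) \<times> (real^'n^'n) \<Rightarrow> 'n \<times> 'n \<Rightarrow> (real^'n^'n) \<times> (real^'n^'n) \<Rightarrow> real"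
where
  "prediction_jacobian AB ij b = frechet_derivative (prediction ij) (at AB) b"

definition jacobian_singular_values ::
  "('n \<times> 'n) set \<Rightarrow> real^'n^'n \<Rightarrow> real^'n^'n \<Rightarrow> real set" where
  "jacobian_singular_values \<Omega> A B = singular_values \<Omega> Basis (prediction_jacobian (A, B))"

definition spectral_norm :: "real^'n^'m \<Rightarrow> real" where
  "spectral_norm M = onorm ((*v) M)"

text \<open>The library norm of a matrix is its Frobenius norm.\<close>
lemma norm_eq_frobenius:
  fixes M :: "real^'n^'m"
  shows "norm M = sqrt (\<Sum>i\<in>UNIV. \<Sum>j\<in>UNIV. (M $ i $ j)\<^sup>2)"
  by (simp add: norm_vec_def L2_set_def sum_nonneg)

text \<open>By division by zero, the zero matrix has stable rank 0.\<close>
definition srank :: "real^'n^'m \<Rightarrow> real" where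
  "srank M = (norm M)\<^sup>2 / (spectral_norm M)\<^sup>2"

end

theory Submission
  imports Defs
begin

text \<open>
  Write \<open>K(V) = (V B\<^sup>T, A\<^sup>T V)\<close> for the adjoint of the Jacobian at \<open>(A, B)\<close> and \<open>R\<close> for the residual on
  the observed positions. The flow is \<open>(A, B)' = - K(R)\<close>, so the loss \<open>L\<close> satisfies \<open>L' = - |K(R)|\<^sup>2\<close>.
  At time \<open>T1\<close> one has \<open>|K(V)| \<ge> \<sigma>min |V|\<close>, and \<open>K\<close> is 1-Lipschitz in \<open>(A, B)\<close>; hence
  \<open>|K(R)|\<^sup>2 \<ge> (\<sigma>min\<^sup>2 / 2) L\<close> as long as the path stays within \<open>\<sigma>min / 2\<close> of its position at \<open>T1\<close>. While this
  holds the loss decays exponentially and the path has length at most \<open>sqrt (8 L(T1)) / \<sigma>min\<close>, which the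
  smallness assumption bounds by \<open>\<sigma>min / (12 sqrt d)\<close>; so the path never leaves the ball. For the stable
  rank, balancedness is conserved, which makes the norms of \<open>A\<close> and \<open>B\<close> agree, and gives
  \<open>\<sigma>min \<le> sqrt 2 |A(T1)|\<close>, so that the numerator of the lower bound is nonnegative.
\<close>

section \<open>Matrix products and transposes in the Frobenius inner product\<close>

lemma inner_matrix_mult_left:
  fixes X :: "real^'n^'m" and Y :: "real^'k^'n" and Z :: "real^'k^'m"
  shows "(X ** Y) \<bullet> Z = X \<bullet> (Z ** transpose Y)"
proof -
  have "(X ** Y) \<bullet> Z = (\<Sum>i\<in>UNIV. \<Sum>j\<in>UNIV. \<Sum>k\<in>UNIV. X$i$k * Y$k$j * Z$i$j)"
    by (simp add: inner_vec_def matrix_matrix_mult_def sum_distrib_right)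
  also have "\<dots> = (\<Sum>i\<in>UNIV. \<Sum>k\<in>UNIV. \<Sum>j\<in>UNIV. X$i$k * Y$k$j * Z$i$j)"
    by (intro sum.cong refl sum.swap)
  also have "\<dots> = X \<bullet> (Z ** transpose Y)"
    by (simp add: inner_vec_def matrix_matrix_mult_def transpose_def sum_distrib_left mult_ac)
  finally show ?thesis .
qed

lemma inner_transpose:
  fixes X Y :: "real^'n^'m"
  shows "transpose X \<bullet> transpose Y = X \<bullet> Y"
  unfolding inner_vec_def transpose_def by (simp) (rule sum.swap)

lemma inner_matrix_mult_right:
  fixes X :: "real^'n^'m" and Y :: "real^'k^'n" and Z :: "real^'k^'m"
  shows "(X ** Y) \<bullet> Z = Y \<bullet> (transpose X ** Z)"
  using inner_matrix_mult_left[of "transpose Y" "transpose X" "transpose Z"]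
    inner_transpose[of Y "transpose X ** Z"] inner_transpose[of "X ** Y" Z]
  by (simp add: matrix_transpose_mul)

lemma norm_transpose:
  fixes X :: "real^'n^'m"
  shows "norm (transpose X) = norm X"
  by (simp add: norm_eq_sqrt_inner inner_transpose)

lemma norm_matrix_mult_vec_le:
  fixes A :: "real^'n^'m"
  shows "norm (A *v x) \<le> norm A * norm x"
proof -
  have "norm (A *v x) = L2_set (\<lambda>i. A $ i \<bullet> x) UNIV"
    by (simp add: norm_vec_def matrix_vector_mult_def inner_vec_def L2_set_def)
  also have "\<dots> \<le> L2_set (\<lambda>i. norm (A $ i) * norm x) UNIV"
    unfolding L2_set_def real_sqrt_le_iff
    by (intro sum_mono) (metis Cauchy_Schwarz_ineq2 abs_ge_zero power2_abs power_mono)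
  also have "\<dots> = norm A * norm x"
    by (simp add: L2_set_left_distrib norm_vec_def)
  finally show ?thesis .
qed

text \<open>Each row of \<open>X ** Y\<close> is \<open>transpose Y\<close> applied to the same row
  of \<open>X\<close>, so the matrix-vector bound applies row by row.\<close>

lemma norm_matrix_mult_le:
  fixes X :: "real^'n^'m" and Y :: "real^'k^'n"
  shows "norm (X ** Y) \<le> norm X * norm Y"
proof -
  have row: "(X ** Y) $ i = transpose Y *v (X $ i)" for i
    by (simp add: vec_eq_iff matrix_matrix_mult_def matrix_vector_mult_def transpose_def mult.commute)
  have "norm (X ** Y) = L2_set (\<lambda>i. norm (transpose Y *v (X $ i))) UNIV"
    by (simp add: norm_vec_def[of "X ** Y"] row)
  also have "\<dots> \<le> L2_set (\<lambda>i. norm (X $ i) * norm Y) UNIV"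
  proof (rule L2_set_mono)
    show "norm (transpose Y *v (X $ i)) \<le> norm (X $ i) * norm Y" for i
      using norm_matrix_mult_vec_le[of "transpose Y" "X $ i"]
      unfolding norm_transpose by (simp only: mult.commute)
  qed simp
  also have "\<dots> = norm X * norm Y"
    by (simp add: L2_set_left_distrib norm_vec_def[of X])
  finally show ?thesis .
qed

lemma bounded_bilinear_matrix_mult:
  "bounded_bilinear ((**) :: real^'n^'m \<Rightarrow> real^'k^'n \<Rightarrow> real^'k^'m)"
proof
  show "\<exists>K. \<forall>a b. norm ((a :: real^'n^'m) ** (b :: real^'k^'n)) \<le> norm a * norm b * K"
    using norm_matrix_mult_le by (metis mult.right_neutral)
qed (simp_all add: vec_eq_iff matrix_matrix_mult_def sum.distrib algebra_simps sum_distrib_left)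

lemma bounded_linear_transpose:
  "bounded_linear (transpose :: real^'n^'m \<Rightarrow> real^'m^'n)"
  unfolding linear_conv_bounded_linear[symmetric]
  by (simp add: linear_iff vec_eq_iff transpose_def)

section \<open>The spectral norm\<close>

lemma spectral_norm_ge: "norm (M *v x) \<le> spectral_norm M * norm x"
  for M :: "real^'n^'m"
  unfolding spectral_norm_def by (rule onorm) simp

lemma spectral_norm_le_norm: "spectral_norm M \<le> norm M"
  for M :: "real^'n^'m"
  unfolding spectral_norm_def by (rule onorm_le) (rule norm_matrix_mult_vec_le)

lemma spectral_norm_triangle: "spectral_norm (M + N) \<le> spectral_norm M + spectral_norm N"
  for M :: "real^'n^'m"
  unfolding spectral_norm_def matrix_vector_mult_add_rdistrib
  by (rule onorm_triangle) simp_all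

lemma spectral_norm_nonneg: "0 \<le> spectral_norm M"
  for M :: "real^'n^'m"
  unfolding spectral_norm_def by (rule onorm_pos_le) simp

lemma spectral_norm_pos: "0 < spectral_norm M" if "M \<noteq> 0"
  for M :: "real^'n^'m"
proof -
  have "\<exists>x. M *v x \<noteq> 0"
    using that by (metis matrix_eq matrix_vector_mult_0)
  then show ?thesis
    unfolding spectral_norm_def by (subst onorm_pos_lt) auto
qed

text \<open>The square of |M^T x| equals the inner product of M M^T x with x, which is at most |M|
  |M^T x| |x|; one factor |M^T x| cancels.\<close>

lemma spectral_norm_transpose_le: "spectral_norm (transpose M) \<le> spectral_norm M"
  for M :: "real^'n^'m"
  unfolding spectral_norm_def[of "transpose M"]
proof (rule onorm_le)
  fix x
  have "norm (transpose M *v x) ^ 2 = (M *v (transpose M *v x)) \<bullet> x"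
    by (simp add: power2_norm_eq_inner dot_lmul_matrix[symmetric] inner_commute)
  also have "\<dots> \<le> norm (M *v (transpose M *v x)) * norm x"
    by (rule norm_cauchy_schwarz)
  also have "\<dots> \<le> spectral_norm M * norm (transpose M *v x) * norm x"
    by (intro mult_right_mono spectral_norm_ge) simp
  finally have "norm (transpose M *v x) * norm (transpose M *v x)
      \<le> (spectral_norm M * norm x) * norm (transpose M *v x)"
    by (simp add: power2_eq_square mult_ac)
  then show "norm (transpose M *v x) \<le> spectral_norm M * norm x"
    using spectral_norm_nonneg[of M]
    by (cases "norm (transpose M *v x) = 0") (auto simp: mult_le_cancel_right)
qed

lemma spectral_norm_transpose: "spectral_norm (transpose M) = spectral_norm M"
  for M :: "real^'n^'m"
  using spectral_norm_transpose_le[of M] spectral_norm_transpose_le[of "transpose M"]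
  by simp

section \<open>Norms determined by the Gram matrix\<close>

text \<open>The inner product with \<open>mat 1\<close> is the trace, so the Frobenius norm depends
  only on the Gram matrix.\<close>

lemma norm_transpose_mult_self:
  fixes A :: "real^'n^'m"
  shows "norm A ^ 2 = mat 1 \<bullet> (transpose A ** A)"
  using inner_matrix_mult_right[of A "mat 1" A]
  by (simp add: power2_norm_eq_inner)

text \<open>The Gram matrix determines |M x| for every x, even when the two matrices have different
  numbers of rows.\<close>

lemma spectral_norm_gram_le:
  fixes A :: "real^'n^'m" and B :: "real^'n^'k"
  assumes "transpose A ** A = transpose B ** B"
  shows "spectral_norm A \<le> spectral_norm B"
  unfolding spectral_norm_def[of A]
proof (rule onorm_le)
  fix x
  have gram: "norm (M *v x) ^ 2 = x \<bullet> ((transpose M ** M) *v x)" for M :: "real^'n^'l"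
    by (simp add: power2_norm_eq_inner dot_lmul_matrix[symmetric] inner_commute
        flip: matrix_vector_mul_assoc)
  have "norm (A *v x) = norm (B *v x)"
    by (rule power2_eq_imp_eq) (simp_all only: gram assms norm_ge_zero)
  then show "norm (A *v x) \<le> spectral_norm B * norm x"
    using spectral_norm_ge[of B x] by simp
qed

text \<open>Balancedness says that \<open>A\<close> and \<open>transpose B\<close> have the same
  Gram matrix, and both norms are invariant under transposition.\<close>

lemma balanced_same_norms:
  fixes A B :: "real^'n^'n"
  assumes "transpose A ** A = B ** transpose B"
  shows "norm A = norm B" "spectral_norm A = spectral_norm B" "srank A = srank B"
proof -
  have *: "transpose A ** A = transpose (transpose B) ** transpose B"
    using assms by simp
  have "norm A ^ 2 = norm (transpose B) ^ 2"
    unfolding norm_transpose_mult_self * ..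
  then show n: "norm A = norm B"
    by (simp add: power2_eq_iff_nonneg norm_transpose)
  show s: "spectral_norm A = spectral_norm B"
    using spectral_norm_gram_le[OF *] spectral_norm_gram_le[OF *[symmetric]]
    by (simp add: spectral_norm_transpose)
  show "srank A = srank B"
    by (simp add: srank_def n s)
qed

section \<open>Eigenvalues of a Gram form on a subspace\<close>

text \<open>Eigenvectors of distinct eigenvalues are orthogonal, hence independent, and the
  dimension is finite. This makes \<open>Min\<close> and \<open>Max\<close> of the singular values
  meaningful.\<close>

lemma finite_gram_eigenvalues:
  fixes K :: "'a::euclidean_space \<Rightarrow> 'b::real_inner"
  shows "finite {\<mu>. \<exists>v\<in>S. v \<noteq> 0 \<and> (\<forall>w\<in>S. K v \<bullet> K w = \<mu> * (v \<bullet> w))}" (is "finite ?E")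
proof -
  obtain v where v: "\<And>\<mu>. \<mu> \<in> ?E \<Longrightarrow> v \<mu> \<in> S \<and> v \<mu> \<noteq> 0 \<and> (\<forall>w\<in>S. K (v \<mu>) \<bullet> K w = \<mu> * (v \<mu> \<bullet> w))"
    using bchoice[of ?E "\<lambda>\<mu> v. v \<in> S \<and> v \<noteq> 0 \<and> (\<forall>w\<in>S. K v \<bullet> K w = \<mu> * (v \<bullet> w))"] by blast
  have orth: "v \<mu> \<bullet> v \<nu> = 0" if "\<mu> \<in> ?E" "\<nu> \<in> ?E" "\<mu> \<noteq> \<nu>" for \<mu> \<nu>
  proof -
    have "\<mu> * (v \<mu> \<bullet> v \<nu>) = \<nu> * (v \<mu> \<bullet> v \<nu>)"
      using v[OF that(1)] v[OF that(2)] by (metis inner_commute)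
    then show ?thesis using that(3) by simp
  qed
  have "inj_on v ?E"
  proof (rule inj_onI, rule ccontr)
    fix \<mu> \<nu> assume *: "\<mu> \<in> ?E" "\<nu> \<in> ?E" "v \<mu> = v \<nu>" "\<mu> \<noteq> \<nu>"
    show False
      using orth[OF *(1,2,4)] v[OF *(1)] by (simp add: *(3))
  qed
  moreover have "independent (v ` ?E)"
  proof (rule pairwise_orthogonal_independent)
    show "pairwise orthogonal (v ` ?E)"
      unfolding pairwise_image using orth by (simp add: pairwise_def orthogonal_def)
    show "0 \<notin> v ` ?E"
      using v by (metis (no_types, lifting) imageE)
  qed
  then have "finite (v ` ?E)"
    using independent_bound by blast
  ultimately show ?thesis
    by (rule finite_imageD[rotated])
qed

text \<open>A minimiser of the Rayleigh quotient exists by compactness of the unit sphere of the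
  subspace, and the first-order condition there is the eigenvalue equation in weak form.\<close>

lemma min_gram_eigenvalue:
  fixes K :: "'a::euclidean_space \<Rightarrow> 'b::euclidean_space"
  assumes "linear K" "subspace S" "x \<in> S" "x \<noteq> 0"
  obtains \<mu> v where "v \<in> S" "v \<noteq> 0" "\<And>w. w \<in> S \<Longrightarrow> K v \<bullet> K w = \<mu> * (v \<bullet> w)"
    "\<And>w. w \<in> S \<Longrightarrow> \<mu> * (norm w)\<^sup>2 \<le> (norm (K w))\<^sup>2"
proof -
  interpret K: linear K by fact
  let ?C = "S \<inter> sphere 0 1"
  have "compact ?C"
    using assms(2) by (intro closed_Int_compact closed_subspace) auto
  moreover have "(1 / norm x) *\<^sub>R x \<in> ?C"
    using assms by (auto simp: subspace_scale)
  moreover have "continuous_on ?C (\<lambda>w. (norm (K w))\<^sup>2)"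
    using assms(1) by (intro continuous_intros linear_continuous_on linear_conv_bounded_linear[THEN iffD1])
  ultimately obtain v where v: "v \<in> ?C" "\<And>w. w \<in> ?C \<Longrightarrow> (norm (K v))\<^sup>2 \<le> (norm (K w))\<^sup>2"
    using continuous_attains_inf[of ?C "\<lambda>w. (norm (K w))\<^sup>2"] by blast
  define \<mu> where "\<mu> = (norm (K v))\<^sup>2"
  have min: "\<mu> * (norm w)\<^sup>2 \<le> (norm (K w))\<^sup>2" if "w \<in> S" for w
  proof (cases "w = 0")
    case False
    then have "(1 / norm w) *\<^sub>R w \<in> ?C"
      using that assms(2) by (auto simp: subspace_scale)
    then have "\<mu> \<le> (norm (K w) / norm w)\<^sup>2"
      using v(2) by (fastforce simp: \<mu>_def K.scale)
    then show ?thesis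
      using False by (simp add: power_divide field_simps)
  qed (simp add: K.zero)
  have "K v \<bullet> K w = \<mu> * (v \<bullet> w)" if "w \<in> S" for w
  proof -
    define b where "b = K v \<bullet> K w - \<mu> * (v \<bullet> w)"
    define c where "c = (norm (K w))\<^sup>2 - \<mu> * (norm w)\<^sup>2"
    \<comment> \<open>Minimality tested at \<open>v + t *\<^sub>R w\<close>. This quadratic in
      \<open>t\<close> vanishes at 0 and is nowhere negative, so its linear coefficient must be
      zero.\<close>
    have q: "0 \<le> 2 * t * b + t\<^sup>2 * c" for t
    proof -
      have "\<mu> * (norm (v + t *\<^sub>R w))\<^sup>2 \<le> (norm (K (v + t *\<^sub>R w)))\<^sup>2"
        using v(1) that assms(2) by (intro min subspace_add subspace_scale) auto
      moreover have "(norm v)\<^sup>2 = 1"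
        using v(1) by simp
      ultimately show ?thesis
        unfolding b_def c_def K.add K.scale \<mu>_def power2_norm_eq_inner
        by (simp add: inner_add inner_commute algebra_simps power2_eq_square)
    qed
    have "c \<ge> 0"
      using min[OF that] by (simp add: c_def)
    have "b = 0"
    proof (rule ccontr)
      assume "b \<noteq> 0"
      \<comment> \<open>At \<open>t = - e\<close> the quadratic equals
        \<open>- e\<^sup>2 * (c + 2)\<close>, which is negative. Dividing by \<open>c + 1\<close>
        instead of \<open>c\<close> covers \<open>c = 0\<close>.\<close>
      define e where "e = b / (c + 1)"
      have b: "b = e * (c + 1)" and "e \<noteq> 0"
        using \<open>c \<ge> 0\<close> \<open>b \<noteq> 0\<close> by (auto simp: e_def)
      have "0 < e\<^sup>2 * (c + 2)"
        using \<open>c \<ge> 0\<close> \<open>e \<noteq> 0\<close> by simp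
      then show False
        using q[of "- e"] by (simp add: b algebra_simps power2_eq_square)
    qed
    then show ?thesis by (simp add: b_def)
  qed
  with min v(1) show ?thesis
    by (intro that[of v \<mu>]) auto
qed

section \<open>Projection onto the observed positions, and the adjoint Jacobian\<close>

text \<open>Vectors indexed by \<open>\<Omega>\<close> are encoded as full matrices that vanish off
  \<open>\<Omega>\<close>, so that residuals can be multiplied with the factors. This map is the
  orthogonal projection onto such matrices.\<close>

definition entry_mask :: "('n \<times> 'n) set \<Rightarrow> real^'n^'n \<Rightarrow> real^'n^'n" where
  "entry_mask \<Omega> M = (\<chi> i j. if (i, j) \<in> \<Omega> then M $ i $ j else 0)"

lemma linear_entry_mask: "linear (entry_mask \<Omega>)"
  by (simp add: linear_iff entry_mask_def vec_eq_iff)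

lemma bounded_linear_entry_mask: "bounded_linear (entry_mask \<Omega>)"
  using linear_entry_mask linear_conv_bounded_linear by blast

lemma entry_mask_idem [simp]: "entry_mask \<Omega> (entry_mask \<Omega> M) = entry_mask \<Omega> M"
  by (simp add: entry_mask_def vec_eq_iff)

lemma inner_entry_mask: "entry_mask \<Omega> M \<bullet> N = (\<Sum>(i, j)\<in>\<Omega>. M $ i $ j * N $ i $ j)"
proof -
  have "entry_mask \<Omega> M \<bullet> N = (\<Sum>i\<in>UNIV. \<Sum>j\<in>UNIV. if (i, j) \<in> \<Omega> then M $ i $ j * N $ i $ j else 0)"
    unfolding inner_vec_def entry_mask_def by (intro sum.cong) auto
  also have "\<dots> = (\<Sum>ij\<in>UNIV \<times> UNIV. if ij \<in> \<Omega> then M $ fst ij $ snd ij * N $ fst ij $ snd ij else 0)"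
    by (simp add: sum.cartesian_product split_def)
  also have "\<dots> = (\<Sum>(i, j)\<in>\<Omega>. M $ i $ j * N $ i $ j)"
    by (simp add: sum.If_cases split_def)
  finally show ?thesis .
qed

lemma inner_entry_mask_commute: "entry_mask \<Omega> M \<bullet> N = M \<bullet> entry_mask \<Omega> N"
  unfolding inner_commute[of M "entry_mask \<Omega> N"] by (simp add: inner_entry_mask mult.commute)

lemma subspace_entry_mask: "subspace {V. entry_mask \<Omega> V = V}"
  using linear_entry_mask[of \<Omega>] by (auto simp: subspace_def linear_iff linear_0[OF linear_entry_mask])

lemma loss_eq_norm_entry_mask: "loss Wstar W \<Omega> = 1/2 * (norm (entry_mask \<Omega> (W - Wstar)))\<^sup>2"
proof -
  have "(norm (entry_mask \<Omega> (W - Wstar)))\<^sup>2 = entry_mask \<Omega> (W - Wstar) \<bullet> (W - Wstar)"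
    unfolding power2_norm_eq_inner by (simp add: inner_entry_mask_commute[symmetric])
  then show ?thesis
    by (simp add: loss_def inner_entry_mask power2_eq_square)
qed

text \<open>On matrices \<open>V\<close> supported on the observed positions this is the transposed Jacobian.\<close>
definition jac_adj :: "real^'n^'n \<Rightarrow> real^'n^'n \<Rightarrow> real^'n^'n \<Rightarrow> (real^'n^'n) \<times> (real^'n^'n)" where
  "jac_adj A B V = (V ** transpose B, transpose A ** V)"

lemma linear_jac_adj:
  fixes A B :: "real^'n^'n"
  shows "linear (jac_adj A B)"
proof -
  interpret bounded_bilinear "(**) :: real^'n^'n \<Rightarrow> real^'n^'n \<Rightarrow> real^'n^'n"
    by (rule bounded_bilinear_matrix_mult)
  show ?thesis
    by (simp add: linear_iff jac_adj_def add_left add_right scaleR_left scaleR_right)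
qed

text \<open>The adjoint relation: \<open>fst h ** B + A ** snd h\<close> is the derivative of the
  product in direction \<open>h\<close>.\<close>

lemma inner_jac_adj: "h \<bullet> jac_adj A B V = (fst h ** B + A ** snd h) \<bullet> V"
  by (simp add: jac_adj_def inner_prod_def inner_add_left inner_matrix_mult_left[of _ B]
      inner_matrix_mult_right[of A])

text \<open>The map is linear in the pair of factors, so the difference has the same form with
  \<open>A - A'\<close> and \<open>B - B'\<close>. Submultiplicativity in each component, summed in
  squares, gives the constant 1.\<close>

lemma jac_adj_lipschitz:
  fixes A B A' B' V :: "real^'n^'n"
  shows "norm (jac_adj A B V - jac_adj A' B' V) \<le> norm ((A, B) - (A', B')) * norm V"
proof -
  interpret bounded_bilinear "(**) :: real^'n^'n \<Rightarrow> real^'n^'n \<Rightarrow> real^'n^'n"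
    by (rule bounded_bilinear_matrix_mult)
  have tr: "transpose X - transpose Y = transpose (X - Y)" for X Y :: "real^'n^'n"
    by (simp add: transpose_def vec_eq_iff)
  have eq: "jac_adj A B V - jac_adj A' B' V = (V ** transpose (B - B'), transpose (A - A') ** V)"
    unfolding jac_adj_def diff_Pair diff_left[symmetric] diff_right[symmetric] tr ..
  have "norm (V ** transpose (B - B')) \<le> norm (B - B') * norm V"
    using norm_matrix_mult_le[of V "transpose (B - B')"] unfolding norm_transpose by (simp only: mult.commute)
  moreover have "norm (transpose (A - A') ** V) \<le> norm (A - A') * norm V"
    using norm_matrix_mult_le[of "transpose (A - A')" V] unfolding norm_transpose .
  ultimately have "(norm (V ** transpose (B - B')))\<^sup>2 + (norm (transpose (A - A') ** V))\<^sup>2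
      \<le> (norm (B - B') * norm V)\<^sup>2 + (norm (A - A') * norm V)\<^sup>2"
    by (intro add_mono power_mono) auto
  also have "\<dots> = ((norm (A - A'))\<^sup>2 + (norm (B - B'))\<^sup>2) * (norm V)\<^sup>2"
    by (simp add: power_mult_distrib algebra_simps)
  finally have "sqrt ((norm (V ** transpose (B - B')))\<^sup>2 + (norm (transpose (A - A') ** V))\<^sup>2)
      \<le> sqrt (((norm (A - A'))\<^sup>2 + (norm (B - B'))\<^sup>2) * (norm V)\<^sup>2)"
    by (rule real_sqrt_le_mono)
  then show ?thesis
    unfolding eq norm_prod_def fst_conv snd_conv diff_Pair real_sqrt_mult by simp
qed

section \<open>The Jacobian of the predictions and its singular values\<close>

lemma has_derivative_prediction:
  "(prediction ij has_derivative (\<lambda>h. (fst h ** B + A ** snd h) $ fst ij $ snd ij)) (at (A, B))"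
proof -
  have "((\<lambda>AB. fst AB ** snd AB) has_derivative (\<lambda>h. A ** snd h + fst h ** B)) (at (A, B))"
    using bounded_bilinear.FDERIV[OF bounded_bilinear_matrix_mult
        has_derivative_fst[OF has_derivative_ident] has_derivative_snd[OF has_derivative_ident],
        of "(A, B)" UNIV]
    by simp
  then have "((\<lambda>AB. (fst AB ** snd AB) $ fst ij $ snd ij) has_derivative
      (\<lambda>h. (A ** snd h + fst h ** B) $ fst ij $ snd ij)) (at (A, B))"
    by (intro bounded_linear.has_derivative[OF bounded_linear_vec_nth])
  then show ?thesis
    unfolding prediction_def add.commute[of "_ ** B"] .
qed

lemma prediction_jacobian_eq:
  "prediction_jacobian (A, B) ij h = (fst h ** B + A ** snd h) $ fst ij $ snd ij"
  unfolding prediction_jacobian_def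
  by (simp only: frechet_derivative_at[OF has_derivative_prediction, symmetric])

lemma sum_prediction_jacobian:
  assumes "entry_mask \<Omega> V = V"
  shows "(\<Sum>r\<in>\<Omega>. prediction_jacobian (A, B) r h * V $ fst r $ snd r) = h \<bullet> jac_adj A B V"
proof -
  have "h \<bullet> jac_adj A B V = entry_mask \<Omega> (fst h ** B + A ** snd h) \<bullet> V"
    by (simp add: inner_jac_adj inner_entry_mask_commute assms)
  then show ?thesis
    by (simp add: inner_entry_mask prediction_jacobian_eq split_def)
qed

text \<open>In coordinates the left side pairs W with J J^T V, where J is the Jacobian; moving J
  over by adjointness and expanding in the basis gives the right side.\<close>

lemma sum_jacobian_gram:
  assumes "entry_mask \<Omega> V = V" "entry_mask \<Omega> W = W"
  shows "(\<Sum>r\<in>\<Omega>. W $ fst r $ snd r *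
      (\<Sum>r'\<in>\<Omega>. (\<Sum>c\<in>Basis. prediction_jacobian (A, B) r c * prediction_jacobian (A, B) r' c)
        * V $ fst r' $ snd r'))
    = jac_adj A B V \<bullet> jac_adj A B W"
proof -
  let ?J = "prediction_jacobian (A, B)"
  have "(\<Sum>r'\<in>\<Omega>. (\<Sum>c\<in>Basis. ?J r c * ?J r' c) * V $ fst r' $ snd r')
      = (\<Sum>c\<in>Basis. ?J r c * (c \<bullet> jac_adj A B V))" for r
    unfolding sum_prediction_jacobian[OF assms(1), symmetric] sum_distrib_right sum_distrib_left
    by (subst sum.swap) (simp add: mult_ac)
  then have "(\<Sum>r\<in>\<Omega>. W $ fst r $ snd r *
      (\<Sum>r'\<in>\<Omega>. (\<Sum>c\<in>Basis. ?J r c * ?J r' c) * V $ fst r' $ snd r'))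
    = (\<Sum>r\<in>\<Omega>. \<Sum>c\<in>Basis. W $ fst r $ snd r * (?J r c * (c \<bullet> jac_adj A B V)))"
    by (simp only: sum_distrib_left)
  also have "\<dots> = (\<Sum>c\<in>Basis. (\<Sum>r\<in>\<Omega>. ?J r c * W $ fst r $ snd r) * (c \<bullet> jac_adj A B V))"
    unfolding sum_distrib_right by (subst sum.swap) (simp add: mult_ac)
  also have "\<dots> = jac_adj A B V \<bullet> jac_adj A B W"
    unfolding sum_prediction_jacobian[OF assms(2)]
    by (subst euclidean_inner) (simp add: inner_commute mult.commute)
  finally show ?thesis .
qed

text \<open>Translates the coordinate eigenvalue equation for J J^T into its weak form on matrices
  supported on \<open>\<Omega>\<close>, to which the results on Gram forms apply.\<close>

lemma jacobian_singular_values_eq: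
  "jacobian_singular_values \<Omega> A B = sqrt ` {\<mu>. \<exists>V\<in>{V. entry_mask \<Omega> V = V}. V \<noteq> 0 \<and>
     (\<forall>W\<in>{V. entry_mask \<Omega> V = V}. jac_adj A B V \<bullet> jac_adj A B W = \<mu> * (V \<bullet> W))}"
proof -
  let ?J = "prediction_jacobian (A, B)"
  let ?G = "\<lambda>v r. \<Sum>r'\<in>\<Omega>. (\<Sum>c\<in>Basis. ?J r c * ?J r' c) * v r'"
  have "(\<exists>v. (\<exists>r\<in>\<Omega>. v r \<noteq> 0) \<and> (\<forall>r\<in>\<Omega>. ?G v r = \<mu> * v r)) \<longleftrightarrow>
    (\<exists>V. entry_mask \<Omega> V = V \<and> V \<noteq> 0 \<and>
     (\<forall>W. entry_mask \<Omega> W = W \<longrightarrow> jac_adj A B V \<bullet> jac_adj A B W = \<mu> * (V \<bullet> W)))" (is "?L \<longleftrightarrow> ?R") for \<mu>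
  proof
    assume ?L
    then obtain v r0 where v: "r0 \<in> \<Omega>" "v r0 \<noteq> 0" "\<And>r. r \<in> \<Omega> \<Longrightarrow> ?G v r = \<mu> * v r" by blast
    define V :: "real^'a^'a" where "V = entry_mask \<Omega> (\<chi> i j. v (i, j))"
    have Vv: "V $ fst r $ snd r = v r" if "r \<in> \<Omega>" for r
      using that by (simp add: V_def entry_mask_def)
    have V: "entry_mask \<Omega> V = V" by (simp add: V_def)
    have "V \<noteq> 0"
      using Vv[OF v(1)] v(2) by auto
    moreover have "jac_adj A B V \<bullet> jac_adj A B W = \<mu> * (V \<bullet> W)" if W: "entry_mask \<Omega> W = W" for W
    proof -
      have "jac_adj A B V \<bullet> jac_adj A B W = (\<Sum>r\<in>\<Omega>. W $ fst r $ snd r * ?G v r)"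
        unfolding sum_jacobian_gram[OF V W, symmetric] by (simp add: Vv cong: sum.cong)
      also have "\<dots> = (\<Sum>r\<in>\<Omega>. \<mu> * (V $ fst r $ snd r * W $ fst r $ snd r))"
      proof (intro sum.cong refl)
        fix r assume r: "r \<in> \<Omega>"
        show "W $ fst r $ snd r * ?G v r = \<mu> * (V $ fst r $ snd r * W $ fst r $ snd r)"
          unfolding v(3)[OF r] Vv[OF r] by simp
      qed
      also have "\<dots> = \<mu> * (entry_mask \<Omega> V \<bullet> W)"
        unfolding inner_entry_mask by (simp add: sum_distrib_left split_def)
      finally show ?thesis by (simp only: V)
    qed
    ultimately show ?R using V by blast
  next
    assume ?R
    then obtain V where V: "entry_mask \<Omega> V = V" "V \<noteq> 0"
      "\<And>W. entry_mask \<Omega> W = W \<Longrightarrow> jac_adj A B V \<bullet> jac_adj A B W = \<mu> * (V \<bullet> W)" by blast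
    define v where "v r = V $ fst r $ snd r" for r
    have "\<exists>r\<in>\<Omega>. v r \<noteq> 0"
    proof (rule ccontr)
      assume "\<not> ?thesis"
      then have "entry_mask \<Omega> V = 0"
        by (auto simp: v_def entry_mask_def vec_eq_iff)
      then show False using V by simp
    qed
    moreover have "?G v r = \<mu> * v r" if r: "r \<in> \<Omega>" for r
    proof -
      \<comment> \<open>Testing the weak equation with the unit matrix at position \<open>r\<close>
        extracts the coordinate equation for \<open>r\<close>.\<close>
      define W :: "real^'a^'a" where "W = (\<chi> i j. if (i, j) = r then 1 else 0)"
      have W: "entry_mask \<Omega> W = W"
        using r by (auto simp: W_def entry_mask_def vec_eq_iff)
      have pick: "(\<Sum>r'\<in>\<Omega>. W $ fst r' $ snd r' * g r') = g r" for g :: "'a \<times> 'a \<Rightarrow> real"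
      proof -
        have "(\<Sum>r'\<in>\<Omega>. W $ fst r' $ snd r' * g r') = (\<Sum>r'\<in>\<Omega>. if r' = r then g r' else 0)"
          by (intro sum.cong) (auto simp: W_def)
        then show ?thesis using r by simp
      qed
      have "?G v r = jac_adj A B V \<bullet> jac_adj A B W"
        unfolding sum_jacobian_gram[OF V(1) W, symmetric] pick v_def ..
      also have "\<dots> = \<mu> * (entry_mask \<Omega> W \<bullet> V)"
        using V(3)[OF W] W by (simp add: inner_commute)
      also have "entry_mask \<Omega> W \<bullet> V = v r"
        using pick[of v] by (simp add: inner_entry_mask split_def v_def)
      finally show ?thesis .
    qed
    ultimately show ?L by blast
  qed
  then show ?thesis
    unfolding jacobian_singular_values_def singular_values_def by auto
qed

lemma finite_jacobian_singular_values: "finite (jacobian_singular_values \<Omega> A B)"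
  unfolding jacobian_singular_values_eq by (intro finite_imageI finite_gram_eigenvalues)

text \<open>In HOL the square root of a negative number is negative, so the eigenvalue itself has to
  be shown nonnegative; testing the weak equation with its own eigenvector does this.\<close>

lemma jacobian_singular_values_nonneg:
  assumes "\<sigma> \<in> jacobian_singular_values \<Omega> A B"
  shows "0 \<le> \<sigma>"
proof -
  obtain \<mu> V where V: "\<sigma> = sqrt \<mu>" "V \<noteq> 0" "jac_adj A B V \<bullet> jac_adj A B V = \<mu> * (V \<bullet> V)"
    using assms unfolding jacobian_singular_values_eq by blast
  have "0 \<le> \<mu> * (V \<bullet> V)"
    using inner_ge_zero[of "jac_adj A B V"] unfolding V(3) .
  moreover have "0 < V \<bullet> V"
    using V(2) by simp
  ultimately show ?thesis
    using V(1) by (simp add: zero_le_mult_iff)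
qed

text \<open>The minimal Rayleigh quotient is an eigenvalue, so its root is a singular value and
  \<open>Min\<close> cannot exceed it. This turns the smallest singular value into a lower bound for
  the adjoint Jacobian.\<close>

lemma min_jacobian_singular_value:
  assumes "\<Omega> \<noteq> {}"
  shows "Min (jacobian_singular_values \<Omega> A B) \<in> jacobian_singular_values \<Omega> A B"
    and "entry_mask \<Omega> V = V \<Longrightarrow> Min (jacobian_singular_values \<Omega> A B) * norm V \<le> norm (jac_adj A B V)"
proof -
  \<comment> \<open>The masked all-ones matrix is a nonzero element of the subspace, because
    \<open>\<Omega>\<close> is nonempty.\<close>
  obtain i j where "(i, j) \<in> \<Omega>" using assms by auto
  then have "entry_mask \<Omega> (\<chi> i j. 1) $ i $ j = 1" by (simp add: entry_mask_def)
  then have ne: "entry_mask \<Omega> (\<chi> i j. 1) \<noteq> 0" by auto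
  have mem1: "entry_mask \<Omega> (\<chi> i j. 1) \<in> {V. entry_mask \<Omega> V = V}" by simp
  obtain V0 \<mu> where V0: "V0 \<in> {V. entry_mask \<Omega> V = V}" "V0 \<noteq> 0"
    "\<And>W. W \<in> {V. entry_mask \<Omega> V = V} \<Longrightarrow> jac_adj A B V0 \<bullet> jac_adj A B W = \<mu> * (V0 \<bullet> W)"
    "\<And>W. W \<in> {V. entry_mask \<Omega> V = V} \<Longrightarrow> \<mu> * (norm W)\<^sup>2 \<le> (norm (jac_adj A B W))\<^sup>2"
    by (rule min_gram_eigenvalue[OF linear_jac_adj[of A B] subspace_entry_mask mem1 ne]) (rule that)
  then have mem: "sqrt \<mu> \<in> jacobian_singular_values \<Omega> A B"
    unfolding jacobian_singular_values_eq by blast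
  then show "Min (jacobian_singular_values \<Omega> A B) \<in> jacobian_singular_values \<Omega> A B"
    using finite_jacobian_singular_values by (intro Min_in) auto
  show "Min (jacobian_singular_values \<Omega> A B) * norm V \<le> norm (jac_adj A B V)" if "entry_mask \<Omega> V = V"
  proof -
    have "sqrt (\<mu> * (norm V)\<^sup>2) \<le> sqrt ((norm (jac_adj A B V))\<^sup>2)"
      using V0(4)[of V] that by (intro real_sqrt_le_mono) simp
    then have "sqrt \<mu> * norm V \<le> norm (jac_adj A B V)"
      by (simp add: real_sqrt_mult)
    moreover have "Min (jacobian_singular_values \<Omega> A B) * norm V \<le> sqrt \<mu> * norm V"
      using mem finite_jacobian_singular_values by (intro mult_right_mono Min_le) auto
    ultimately show ?thesis by simp
  qed
qed

section \<open>Derivatives and conserved quantities along the gradient flow\<close>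

text \<open>Both gradients in the definition are determined by uniqueness of the derivative.\<close>
lemma gradient_flow_on_derivative:
  assumes "gradient_flow_on Wstar \<Omega> I A B" "t \<in> I"
  defines "N \<equiv> entry_mask \<Omega> (A t ** B t - Wstar)"
  shows "(A has_vector_derivative - (N ** transpose (B t))) (at t within I)"
    and "(B has_vector_derivative - (transpose (A t) ** N)) (at t within I)"
proof -
  \<comment> \<open>Chain rule for the loss along any differentiable matrix map; by self-adjointness
    and idempotence of the mask, the masked residual alone represents the derivative.\<close>
  have loss: "((\<lambda>X. loss Wstar (f X) \<Omega>) has_derivative (\<lambda>h. entry_mask \<Omega> (f X0 - Wstar) \<bullet> f' h)) (at X0)"
    if f: "(f has_derivative f') (at X0)" for f f' and X0 :: "real^'a^'a"
  proof -
    have "((\<lambda>X. entry_mask \<Omega> (f X - Wstar)) has_derivative (\<lambda>h. entry_mask \<Omega> (f' h - 0))) (at X0)"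
      by (intro bounded_linear.has_derivative[OF bounded_linear_entry_mask] has_derivative_diff f has_derivative_const)
    note d = has_derivative_mult_right[OF has_derivative_inner[OF this this], of "1/2"]
    define c where "c = entry_mask \<Omega> (f X0 - Wstar)"
    have "c \<bullet> entry_mask \<Omega> (f' h) = c \<bullet> f' h" for h
      using inner_entry_mask_commute[of \<Omega> c "f' h"] by (simp add: c_def)
    then have "1/2 * (c \<bullet> entry_mask \<Omega> (f' h - 0) + entry_mask \<Omega> (f' h - 0) \<bullet> c) = c \<bullet> f' h" for h
      by (simp add: inner_commute[of "entry_mask \<Omega> (f' h)" c])
    then show ?thesis
      unfolding loss_eq_norm_entry_mask power2_norm_eq_inner
      using d by (simp only: c_def)
  qed
  have inner_eqD: "x = y" if "(\<lambda>h. h \<bullet> x) = (\<lambda>h. h \<bullet> y)" for x y :: "real^'a^'a"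
    using fun_cong[OF that] by (rule vector_eq_ldot[THEN iffD1, OF allI])
  obtain GA GB where G: "GDERIV (\<lambda>X. loss Wstar (X ** B t) \<Omega>) (A t) :> GA"
    "GDERIV (\<lambda>Y. loss Wstar (A t ** Y) \<Omega>) (B t) :> GB"
    "(A has_vector_derivative - GA) (at t within I)"
    "(B has_vector_derivative - GB) (at t within I)"
    using assms(1,2) unfolding gradient_flow_on_def by blast
  have "((\<lambda>X. X ** B t) has_derivative (\<lambda>h. h ** B t)) (at (A t))"
    by (intro bounded_linear.has_derivative[OF bounded_bilinear.bounded_linear_left[OF bounded_bilinear_matrix_mult]]
        has_derivative_ident)
  from has_derivative_unique[OF G(1)[unfolded gderiv_def] loss[OF this]]
  have "GA = N ** transpose (B t)"
    by (intro inner_eqD) (simp add: N_def inner_commute[of "entry_mask \<Omega> (A t ** B t - Wstar)"] inner_matrix_mult_left[of _ "B t"])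
  then show "(A has_vector_derivative - (N ** transpose (B t))) (at t within I)"
    using G(3) by simp
  have "((\<lambda>Y. A t ** Y) has_derivative (\<lambda>h. A t ** h)) (at (B t))"
    by (intro bounded_linear.has_derivative[OF bounded_bilinear.bounded_linear_right[OF bounded_bilinear_matrix_mult]]
        has_derivative_ident)
  from has_derivative_unique[OF G(2)[unfolded gderiv_def] loss[OF this]]
  have "GB = transpose (A t) ** N"
    by (intro inner_eqD) (simp add: N_def inner_commute[of "entry_mask \<Omega> (A t ** B t - Wstar)"] inner_matrix_mult_right[of "A t"])
  then show "(B has_vector_derivative - (transpose (A t) ** N)) (at t within I)"
    using G(4) by simp
qed

lemma gradient_flow_on_has_vector_derivative:
  assumes "gradient_flow_on Wstar \<Omega> I A B" "t \<in> I"
  shows "((\<lambda>t. (A t, B t)) has_vector_derivative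
     - jac_adj (A t) (B t) (entry_mask \<Omega> (A t ** B t - Wstar))) (at t within I)"
  using has_vector_derivative_Pair[OF gradient_flow_on_derivative[OF assms]]
  by (simp add: jac_adj_def)

text \<open>The adjoint Jacobian at the residual is the gradient of the loss, and the velocity is
  its negative.\<close>

lemma gradient_flow_on_loss_derivative:
  assumes "gradient_flow_on Wstar \<Omega> I A B" "t \<in> I"
  shows "((\<lambda>t. loss Wstar (A t ** B t) \<Omega>) has_vector_derivative
     - (norm (jac_adj (A t) (B t) (entry_mask \<Omega> (A t ** B t - Wstar))))\<^sup>2) (at t within I)"
proof -
  define N where "N = entry_mask \<Omega> (A t ** B t - Wstar)"
  note deriv = gradient_flow_on_derivative[OF assms, folded N_def]
  let ?A' = "- (N ** transpose (B t))" and ?B' = "- (transpose (A t) ** N)"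
  define D where "D = A t ** ?B' + ?A' ** B t"
  have "((\<lambda>t. A t ** B t) has_vector_derivative D) (at t within I)"
    unfolding D_def by (rule bounded_bilinear.has_vector_derivative[OF bounded_bilinear_matrix_mult deriv])
  then have mask_deriv: "((\<lambda>t. entry_mask \<Omega> (A t ** B t - Wstar)) has_vector_derivative entry_mask \<Omega> (D - 0)) (at t within I)"
    by (intro bounded_linear.has_vector_derivative[OF bounded_linear_entry_mask]
        has_vector_derivative_diff has_vector_derivative_const)
  have "((\<lambda>t. entry_mask \<Omega> (A t ** B t - Wstar) \<bullet> entry_mask \<Omega> (A t ** B t - Wstar)) has_vector_derivative
      (N \<bullet> entry_mask \<Omega> (D - 0) + entry_mask \<Omega> (D - 0) \<bullet> N)) (at t within I)"
    unfolding N_def by (rule bounded_bilinear.has_vector_derivative[OF bounded_bilinear_inner mask_deriv mask_deriv])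
  then have "((\<lambda>t. 1/2 * (entry_mask \<Omega> (A t ** B t - Wstar) \<bullet> entry_mask \<Omega> (A t ** B t - Wstar))) has_vector_derivative
      1/2 * (N \<bullet> entry_mask \<Omega> (D - 0) + entry_mask \<Omega> (D - 0) \<bullet> N)) (at t within I)"
    by (rule bounded_linear.has_vector_derivative[OF bounded_linear_mult_right])
  moreover have "1/2 * (N \<bullet> entry_mask \<Omega> (D - 0) + entry_mask \<Omega> (D - 0) \<bullet> N) = D \<bullet> N"
    unfolding inner_commute[of N] by (simp add: inner_entry_mask_commute N_def)
  moreover have "D \<bullet> N = (?A', ?B') \<bullet> jac_adj (A t) (B t) N"
    by (simp add: inner_jac_adj D_def add.commute)
  moreover have "\<dots> = - (norm (jac_adj (A t) (B t) N))\<^sup>2"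
    by (simp add: power2_norm_eq_inner jac_adj_def)
  ultimately show ?thesis
    unfolding loss_eq_norm_entry_mask power2_norm_eq_inner[of "entry_mask _ _"] N_def by simp
qed

text \<open>With N the masked residual, A^T A and B B^T both have derivative - A^T N B^T - B N^T A.
  Since \<open>\<Omega>\<close> is arbitrary, this serves both training phases.\<close>

lemma gradient_flow_on_balanced:
  fixes A B :: "real \<Rightarrow> real^'n^'n"
  assumes flow: "gradient_flow_on Wstar \<Omega> I A B" and "convex I" "s \<in> I" "t \<in> I"
    and bal: "transpose (A s) ** A s = B s ** transpose (B s)"
  shows "transpose (A t) ** A t = B t ** transpose (B t)"
proof -
  interpret M: bounded_bilinear "(**) :: real^'n^'n \<Rightarrow> real^'n^'n \<Rightarrow> real^'n^'n"
    by (rule bounded_bilinear_matrix_mult)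
  interpret T: bounded_linear "transpose :: real^'n^'n \<Rightarrow> real^'n^'n"
    by (rule bounded_linear_transpose)
  define F where "F = (\<lambda>t. transpose (A t) ** A t - B t ** transpose (B t))"
  have "(F has_vector_derivative 0) (at u within I)" if u: "u \<in> I" for u
  proof -
    note d = gradient_flow_on_derivative[OF flow u]
    show ?thesis
      unfolding F_def
      by (rule has_vector_derivative_eq_rhs[OF has_vector_derivative_diff[OF
              M.has_vector_derivative[OF T.has_vector_derivative[OF d(1)] d(1)]
              M.has_vector_derivative[OF d(2) T.has_vector_derivative[OF d(2)]]]])
        (simp add: T.neg M.minus_left M.minus_right matrix_transpose_mul matrix_mul_assoc)
  qed
  then obtain c where "\<And>u. u \<in> I \<Longrightarrow> F u = c"
    using has_vector_derivative_zero_constant[OF \<open>convex I\<close>] by metis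
  then show ?thesis
    using assms(3-5) by (metis F_def eq_iff_diff_eq_0)
qed

section \<open>Perturbation of the stable rank, and flows with zero loss\<close>

lemma jac_adj_norm_le:
  fixes A B V :: "real^'n^'n"
  shows "norm (jac_adj A B V) \<le> norm (A, B) * norm V"
proof -
  have z: "jac_adj 0 0 V = 0"
    by (simp add: jac_adj_def transpose_def zero_vec_def[symmetric] zero_prod_def)
  show ?thesis
    using jac_adj_lipschitz[of A B V 0 0] unfolding z by (simp add: zero_prod_def[symmetric])
qed

text \<open>The Frobenius norm drops by at most \<open>\<delta>\<close>, and the spectral norm grows
  by at most \<open>\<delta>\<close> because the Frobenius norm dominates it. The bound
  \<open>\<delta> \<le> norm M\<close> keeps the numerator nonnegative, so the quotients can be
  squared.\<close>

lemma srank_perturbation: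
  fixes M M' :: "real^'n^'m"
  assumes "norm (M' - M) \<le> \<delta>" "0 \<le> \<delta>" "\<delta> \<le> norm M"
  shows "((norm M - \<delta>) / (spectral_norm M + \<delta>))\<^sup>2 \<le> srank M'"
proof (cases "M' = 0")
  \<comment> \<open>Here \<open>srank M'\<close> is 0 by convention, but \<open>norm M\<close> then
    equals \<open>\<delta>\<close>, so the lower bound is 0 as well.\<close>
  case True
  then have "norm M = \<delta>" using assms by simp
  then show ?thesis by (simp add: srank_def)
next
  case False
  have "norm M - \<delta> \<le> norm M'"
    using norm_triangle_ineq2[of M M'] assms(1) by (simp add: norm_minus_commute)
  moreover have "spectral_norm M' \<le> spectral_norm M + \<delta>"
    using spectral_norm_triangle[of M "M' - M"] spectral_norm_le_norm[of "M' - M"] assms(1) by simp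
  ultimately have "(norm M - \<delta>) / (spectral_norm M + \<delta>) \<le> norm M' / spectral_norm M'"
    using spectral_norm_pos[OF False] assms(3) by (intro frac_le) auto
  then have "((norm M - \<delta>) / (spectral_norm M + \<delta>))\<^sup>2 \<le> (norm M' / spectral_norm M')\<^sup>2"
    using assms(2,3) spectral_norm_nonneg[of M] by (intro power_mono) auto
  then show ?thesis
    by (simp add: srank_def power_divide)
qed

lemma gradient_flow_on_loss_mono:
  assumes flow: "gradient_flow_on Wstar \<Omega> {a..} A B" and "a \<le> t"
  shows "loss Wstar (A t ** B t) \<Omega> \<le> loss Wstar (A a ** B a) \<Omega>"
proof (rule DERIV_nonpos_imp_decreasing_open[OF \<open>a \<le> t\<close>])
  fix u assume u: "a < u" "u < t"
  then have at: "at u within {a..} = at u" and "u \<in> {a..}"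
    by (auto intro: at_within_interior)
  from gradient_flow_on_loss_derivative[OF flow this(2), unfolded at]
  show "\<exists>y. ((\<lambda>t. loss Wstar (A t ** B t) \<Omega>) has_real_derivative y) (at u) \<and> y \<le> 0"
    unfolding has_real_derivative_iff_has_vector_derivative
    by (intro exI conjI) auto
next
  have "continuous_on {a..} (\<lambda>t. loss Wstar (A t ** B t) \<Omega>)"
    by (rule continuous_on_vector_derivative) (rule gradient_flow_on_loss_derivative[OF flow])
  then show "continuous_on {a..t} (\<lambda>t. loss Wstar (A t ** B t) \<Omega>)"
    by (rule continuous_on_subset) auto
qed

text \<open>A nonnegative nonincreasing loss that starts at 0 stays 0, so the residual and the
  velocity vanish. This covers a degenerate Jacobian, for which no decay rate is available.\<close>

lemma gradient_flow_on_stationary: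
  assumes flow: "gradient_flow_on Wstar \<Omega> {a..} A B" and "a \<le> t"
    and zero: "loss Wstar (A a ** B a) \<Omega> = 0"
  shows "A t = A a" "loss Wstar (A t ** B t) \<Omega> = 0"
proof -
  have nonneg: "0 \<le> loss Wstar W \<Omega>" for W
    by (simp add: loss_eq_norm_entry_mask)
  have L: "loss Wstar (A u ** B u) \<Omega> = 0" if "u \<in> {a..}" for u
    using gradient_flow_on_loss_mono[OF flow, of u] nonneg[of "A u ** B u"] that zero by simp
  then show "loss Wstar (A t ** B t) \<Omega> = 0"
    using \<open>a \<le> t\<close> by simp
  have "(A has_vector_derivative 0) (at u within {a..})" if u: "u \<in> {a..}" for u
    using gradient_flow_on_derivative(1)[OF flow u] L[OF u] by (simp add: loss_eq_norm_entry_mask)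
  then obtain c where "\<And>u. u \<in> {a..} \<Longrightarrow> A u = c"
    using has_vector_derivative_zero_constant[of "{a..}" A] by auto
  then show "A t = A a"
    using \<open>a \<le> t\<close> by simp
qed

section \<open>Convergence from a well-conditioned starting point\<close>

lemma jac_adj_lower_bound_near:
  fixes A B A' B' V :: "real^'n^'n"
  assumes "s * norm V \<le> norm (jac_adj A B V)" "norm ((A', B') - (A, B)) \<le> s / 2"
  shows "s / 2 * norm V \<le> norm (jac_adj A' B' V)"
proof -
  have "norm (jac_adj A B V - jac_adj A' B' V) \<le> norm ((A, B) - (A', B')) * norm V"
    by (rule jac_adj_lipschitz)
  also have "\<dots> \<le> s / 2 * norm V"
    using assms(2) by (intro mult_right_mono) (simp_all only: norm_minus_commute norm_ge_zero)
  finally show ?thesis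
    using assms(1) norm_triangle_ineq2[of "jac_adj A B V" "jac_adj A' B' V"] by linarith
qed

text \<open>Only the lower bound \<open>s\<close> for the adjoint Jacobian at the starting time is
  kept from the singular values; \<open>a\<close> and \<open>s\<close> stand for \<open>T1\<close>
  and \<open>\<sigma>min\<close>.\<close>

locale conditioned_flow =
  fixes Wstar :: "real^'n^'n" and \<Omega> :: "('n \<times> 'n) set" and a s :: real
    and A B :: "real \<Rightarrow> real^'n^'n"
  assumes flow: "gradient_flow_on Wstar \<Omega> {a..} A B"
    and s_pos: "0 < s"
    and conditioned: "entry_mask \<Omega> V = V \<Longrightarrow> s * norm V \<le> norm (jac_adj (A a) (B a) V)"
begin

definition "residual t = entry_mask \<Omega> (A t ** B t - Wstar)"
definition "L t = loss Wstar (A t ** B t) \<Omega>"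
definition "speed t = norm (jac_adj (A t) (B t) (residual t))"

lemma L_nonneg: "0 \<le> L t"
  by (simp add: L_def loss_eq_norm_entry_mask)

lemma theta_deriv:
  assumes "a < t"
  shows "((\<lambda>t. (A t, B t)) has_vector_derivative - jac_adj (A t) (B t) (residual t)) (at t)"
  using gradient_flow_on_has_vector_derivative[OF flow, of t] assms at_within_interior[of t "{a..}"]
  by (simp add: residual_def)

lemma L_deriv:
  assumes "a < t"
  shows "(L has_real_derivative - (speed t)\<^sup>2) (at t)"
  using gradient_flow_on_loss_derivative[OF flow, of t] assms at_within_interior[of t "{a..}"]
  by (simp add: residual_def speed_def L_def[abs_def] has_real_derivative_iff_has_vector_derivative)

lemma theta_cont: "continuous_on {a..t} (\<lambda>t. (A t, B t))"
  by (rule continuous_on_subset[of "{a..}"])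
    (auto intro: continuous_on_vector_derivative gradient_flow_on_has_vector_derivative[OF flow])

lemma L_cont: "continuous_on {a..t} L"
  unfolding L_def[abs_def]
  by (rule continuous_on_subset[of "{a..}"])
    (auto intro: continuous_on_vector_derivative gradient_flow_on_loss_derivative[OF flow])

text \<open>The Polyak--Lojasiewicz inequality.\<close>
lemma speed_lower_bound:
  assumes "norm ((A t, B t) - (A a, B a)) \<le> s / 2"
  shows "s\<^sup>2 / 2 * L t \<le> (speed t)\<^sup>2"
proof -
  have "s / 2 * norm (residual t) \<le> speed t"
    unfolding speed_def
    by (intro jac_adj_lower_bound_near[OF conditioned assms]) (simp add: residual_def)
  then have "(s / 2 * norm (residual t))\<^sup>2 \<le> (speed t)\<^sup>2"
    using s_pos by (intro power_mono) auto
  then show ?thesis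
    by (simp add: L_def loss_eq_norm_entry_mask residual_def power_mult_distrib power_divide field_simps)
qed

text \<open>With \<open>c = s\<^sup>2 / 4\<close>, half of the decay of the loss is kept back as an exponential weight; by AM-GM
  the rest then controls the speed itself, without dividing by the square root of the loss.\<close>
lemma path_bound:
  assumes "a \<le> t" and near: "\<And>u. a < u \<Longrightarrow> u < t \<Longrightarrow> norm ((A u, B u) - (A a, B a)) \<le> s / 2"
    and "0 < \<delta>" and small: "L a \<le> s\<^sup>2 * \<delta>\<^sup>2 / 8"
  shows "norm ((A t, B t) - (A a, B a)) \<le> \<delta>"
proof (cases "t = a")
  case False
  then have "a < t" using \<open>a \<le> t\<close> by simp
  define c where "c = s\<^sup>2 / 4"
  have c: "c > 0" using s_pos by (simp add: c_def)
  define E where "E u = exp (c * (u - a))" for u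
  have E: "E u > 0" for u by (simp add: E_def)
  have Einv: "exp (- c * (u - a)) = 1 / E u" for u
    by (simp add: E_def exp_minus inverse_eq_divide)
  \<comment> \<open>An antiderivative of \<open>\<phi>'\<close>, which will dominate the speed. Its
    two terms contribute at most \<open>\<delta> / 2\<close> and \<open>L a / (c * \<delta>)\<close>
    to the total increase.\<close>
  define \<phi> where "\<phi> u = - (\<delta> / 2 * exp (- c * (u - a))) - E u * L u / (c * \<delta>)" for u
  define \<phi>' where "\<phi>' u = c * \<delta> / 2 / E u + E u / (c * \<delta>) * ((speed u)\<^sup>2 - c * L u)" for u
  have "norm ((A t, B t) - (A a, B a)) \<le> \<phi> t - \<phi> a"
  proof (rule differentiable_bound_general[where f = "\<lambda>t. (A t, B t)" and \<phi>' = \<phi>',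
        OF \<open>a < t\<close> theta_cont _ theta_deriv])
    show "continuous_on {a..t} \<phi>"
      unfolding \<phi>_def E_def by (intro continuous_intros L_cont) (use c \<open>0 < \<delta>\<close> in auto)
    fix u assume u: "a < u" "u < t"
    have dE: "(E has_real_derivative c * E u) (at u)"
      unfolding E_def by (rule derivative_eq_intros refl)+ simp
    have dG: "((\<lambda>u. exp (- c * (u - a))) has_real_derivative - c / E u) (at u)"
      unfolding E_def by (rule derivative_eq_intros refl)+ (simp add: exp_minus divide_inverse)
    have "(\<phi> has_real_derivative - (\<delta> / 2 * (- c / E u))
        - (E u * - (speed u)\<^sup>2 + c * E u * L u) / (c * \<delta>)) (at u)"
      unfolding \<phi>_def
      by (intro DERIV_diff DERIV_minus DERIV_cmult dG DERIV_cdivide DERIV_mult' dE L_deriv u(1))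
    moreover have "- (\<delta> / 2 * (- c / E u)) - (E u * - (speed u)\<^sup>2 + c * E u * L u) / (c * \<delta>) = \<phi>' u"
      unfolding \<phi>'_def using E[of u] c \<open>0 < \<delta>\<close> by (simp add: field_simps)
    ultimately have "(\<phi> has_real_derivative \<phi>' u) (at u)" by simp
    then show "(\<phi> has_vector_derivative \<phi>' u) (at u)"
      by (simp add: has_real_derivative_iff_has_vector_derivative)
    have "2 * (c * L u) \<le> (speed u)\<^sup>2"
      using speed_lower_bound[OF near[OF u]] by (simp add: c_def)
    then have "E u / (c * \<delta>) * ((speed u)\<^sup>2 / 2) \<le> E u / (c * \<delta>) * ((speed u)\<^sup>2 - c * L u)"
      using E[of u] c \<open>0 < \<delta>\<close> by (intro mult_left_mono) auto
    moreover have "speed u \<le> c * \<delta> / 2 / E u + E u / (c * \<delta>) * ((speed u)\<^sup>2 / 2)"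
    proof -
      \<comment> \<open>AM-GM written as a square, balancing \<open>c * \<delta>\<close> against
        \<open>E u * speed u\<close>.\<close>
      have "0 \<le> (c * \<delta> - E u * speed u)\<^sup>2 / (2 * (c * \<delta>) * E u)"
        using E[of u] c \<open>0 < \<delta>\<close> by (intro divide_nonneg_pos) auto
      also have "\<dots> = c * \<delta> / 2 / E u + E u / (c * \<delta>) * ((speed u)\<^sup>2 / 2) - speed u"
        using E[of u] c \<open>0 < \<delta>\<close> by (simp add: power2_eq_square field_simps)
      finally show ?thesis by simp
    qed
    ultimately show "norm (- jac_adj (A u) (B u) (residual u)) \<le> \<phi>' u"
      by (simp add: \<phi>'_def speed_def)
  qed
  also have "\<dots> \<le> 0 - \<phi> a"
  proof -
    have "0 \<le> E t * L t / (c * \<delta>)" "0 \<le> \<delta> / 2 * exp (- c * (t - a))"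
      using E[of t] c \<open>0 < \<delta>\<close> L_nonneg[of t] by simp_all
    then have "\<phi> t \<le> 0" unfolding \<phi>_def by linarith
    then show ?thesis by simp
  qed
  also have "\<dots> = \<delta> / 2 + L a / (c * \<delta>)"
    by (simp add: \<phi>_def E_def)
  \<comment> \<open>With \<open>c = s\<^sup>2 / 4\<close>, the bound on \<open>L a\<close> is
    exactly what makes the second summand at most \<open>\<delta> / 2\<close>.\<close>
  also have "\<dots> \<le> \<delta> / 2 + \<delta> / 2"
    using small c \<open>0 < \<delta>\<close> by (simp add: c_def field_simps power2_eq_square)
  finally show ?thesis by simp
qed (use \<open>0 < \<delta>\<close> in simp)

text \<open>At the first time of leaving the ball of radius \<open>s / 2\<close> the path bound would still apply.\<close>
lemma stays_near:
  assumes "0 < \<delta>" "\<delta> < s / 2" and small: "L a \<le> s\<^sup>2 * \<delta>\<^sup>2 / 8" and "a \<le> t"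
  shows "norm ((A t, B t) - (A a, B a)) \<le> \<delta>"
proof -
  have inside: "norm ((A u, B u) - (A a, B a)) < s / 2" if "u \<in> {a..t}" for u
  proof (rule ccontr)
    assume far: "\<not> ?thesis"
    let ?F = "{v \<in> {a..u}. s / 2 \<le> norm ((A v, B v) - (A a, B a))}"
    have "closed ?F"
      by (intro continuous_on_closed_Collect_le continuous_intros theta_cont) auto
    moreover have "?F \<subseteq> {a..u}" by auto
    ultimately have "compact ?F"
      using bounded_subset[OF bounded_closed_interval] by (auto simp: compact_eq_bounded_closed)
    moreover have "u \<in> ?F" using far that by simp
    ultimately obtain v where v: "v \<in> ?F" "\<And>w. w \<in> ?F \<Longrightarrow> v \<le> w"
      using compact_attains_inf[of ?F] by blast
    have "norm ((A v, B v) - (A a, B a)) \<le> \<delta>"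
    proof (rule path_bound[OF _ _ assms(1) small])
      show "a \<le> v" using v(1) by simp
      show "norm ((A w, B w) - (A a, B a)) \<le> s / 2" if "a < w" "w < v" for w
      proof (rule ccontr)
        assume "\<not> ?thesis"
        then have "w \<in> ?F" using v(1) that by auto
        from v(2)[OF this] show False using that by simp
      qed
    qed
    then show False
      using v(1) assms(2) by simp
  qed
  show ?thesis
  proof (rule path_bound[OF \<open>a \<le> t\<close> _ \<open>0 < \<delta>\<close> small])
    show "norm ((A u, B u) - (A a, B a)) \<le> s / 2" if "a < u" "u < t" for u
      using inside[of u] that by (intro less_imp_le) simp
  qed
qed

text \<open>Gronwall argument: multiplied by the integrating factor
  \<open>exp (s\<^sup>2 / 2 * (u - a))\<close>, the loss is nonincreasing by the Polyak-Lojasiewicz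
  inequality.\<close>

lemma exponential_decay:
  assumes near: "\<And>u. a < u \<Longrightarrow> u < t \<Longrightarrow> norm ((A u, B u) - (A a, B a)) \<le> s / 2" and "a \<le> t"
  shows "L t \<le> L a * exp (- (1/2) * s\<^sup>2 * (t - a))"
proof -
  let ?g = "\<lambda>u. exp (s\<^sup>2 / 2 * (u - a)) * L u"
  have "?g t \<le> ?g a"
  proof (rule DERIV_nonpos_imp_decreasing_open[OF \<open>a \<le> t\<close>])
    fix u assume u: "a < u" "u < t"
    have "(?g has_real_derivative exp (s\<^sup>2 / 2 * (u - a)) * (s\<^sup>2 / 2 * L u - (speed u)\<^sup>2)) (at u)"
      by (rule derivative_eq_intros L_deriv[OF u(1)] refl)+ (simp add: algebra_simps)
    moreover have "exp (s\<^sup>2 / 2 * (u - a)) * (s\<^sup>2 / 2 * L u - (speed u)\<^sup>2) \<le> 0"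
      using speed_lower_bound[OF near[OF u]] by (intro mult_nonneg_nonpos) auto
    ultimately show "\<exists>y. (?g has_real_derivative y) (at u) \<and> y \<le> 0" by blast
  next
    show "continuous_on {a..t} ?g"
      by (intro continuous_intros L_cont)
  qed
  then show ?thesis
    by (simp add: exp_minus field_simps)
qed

end

section \<open>Decay of the loss and the stable rank bound\<close>

theorem theorem4p3:
  fixes A B :: "real \<Rightarrow> real^'n^'n"
    and Wstar :: "real^'n^'n"
    and Omega_post :: "('n \<times> 'n) set"
    and T1 \<sigma>min \<sigma>max :: real
  assumes "0 \<le> T1"
    and "Omega_pre \<subseteq> Omega_post"
    and "gradient_flow_on Wstar Omega_pre {0..T1} A B"
    and "gradient_flow_on Wstar Omega_post {T1..} A B"
    and "transpose (A 0) ** A 0 = B 0 ** transpose (B 0)"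
    and "\<sigma>max = Max (jacobian_singular_values Omega_post (A T1) (B T1))"
    and "\<sigma>min = Min (jacobian_singular_values Omega_post (A T1) (B T1))"
    and "loss Wstar (A T1 ** B T1) Omega_post
           \<le> \<sigma>min ^ 6 / (1152 * real CARD('n) * \<sigma>max\<^sup>2)"
  shows "(\<forall>t\<ge>T1. loss Wstar (A t ** B t) Omega_post
            \<le> loss Wstar (A T1 ** B T1) Omega_post * exp (- (1/2) * \<sigma>min\<^sup>2 * (t - T1))) \<and>
         (\<forall>t\<ge>T1. srank (A t) = srank (B t) \<and>
            srank (A t) \<ge>
              ((norm (A T1) - \<sigma>min / (4 * sqrt (2 * real CARD('n)))) /
               (spectral_norm (A T1) + \<sigma>min / (4 * sqrt (2 * real CARD('n)))))\<^sup>2)"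
proof -
  let ?\<Omega> = Omega_post and ?d = "real CARD('n)"
  let ?L = "\<lambda>t. loss Wstar (A t ** B t) ?\<Omega>"
  let ?\<delta> = "\<sigma>min / (4 * sqrt (2 * ?d))"
  have ne: "?\<Omega> \<noteq> {}"
    using assms(2) by (auto simp: Omega_pre_def)
  have d: "1 \<le> ?d" by (simp add: Suc_le_eq)
  note min_mem = min_jacobian_singular_value(1)[OF ne, of "A T1" "B T1", folded assms(7)]
  have s0: "0 \<le> \<sigma>min"
    using jacobian_singular_values_nonneg[OF min_mem] .
  have cond: "\<sigma>min * norm V \<le> norm (jac_adj (A T1) (B T1) V)" if "entry_mask ?\<Omega> V = V" for V
    using min_jacobian_singular_value(2)[OF ne that] unfolding assms(7) .
  have minmax: "\<sigma>min \<le> \<sigma>max"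
    unfolding assms(6) by (intro Max_ge finite_jacobian_singular_values min_mem)
  have bal1: "transpose (A T1) ** A T1 = B T1 ** transpose (B T1)"
    by (rule gradient_flow_on_balanced[OF assms(3) _ _ _ assms(5)]) (simp_all add: assms(1))
  have bal: "transpose (A t) ** A t = B t ** transpose (B t)" if "T1 \<le> t" for t
    by (rule gradient_flow_on_balanced[OF assms(4) _ _ _ bal1]) (simp_all add: that)
  have s_le: "\<sigma>min \<le> sqrt 2 * norm (A T1)"
  proof -
    obtain i j where "(i, j) \<in> ?\<Omega>" using ne by auto
    then have "entry_mask ?\<Omega> (\<chi> i j. 1) $ i $ j = 1" by (simp add: entry_mask_def)
    then have V: "entry_mask ?\<Omega> (\<chi> i j. 1) \<noteq> 0" (is "?V \<noteq> 0") by auto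
    have "\<sigma>min * norm ?V \<le> norm (A T1, B T1) * norm ?V"
      using cond[OF entry_mask_idem] jac_adj_norm_le by (rule order_trans)
    moreover have "0 < norm ?V" using V by simp
    ultimately have "\<sigma>min \<le> norm (A T1, B T1)"
      by (rule mult_right_le_imp_le)
    also have "\<dots> = sqrt 2 * norm (A T1)"
      using balanced_same_norms(1)[OF bal1] by (simp add: norm_prod_def real_sqrt_mult)
    finally show ?thesis .
  qed
  have \<delta>: "0 \<le> ?\<delta>" using s0 by simp
  have \<delta>_le: "?\<delta> \<le> norm (A T1)"
  proof -
    have "?\<delta> \<le> \<sigma>min / (4 * sqrt 2)"
      using s0 d by (intro divide_left_mono) auto
    also have "\<dots> \<le> sqrt 2 * norm (A T1) / (4 * sqrt 2)"
      using s_le by (intro divide_right_mono) auto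
    also have "\<dots> \<le> norm (A T1)" by simp
    finally show ?thesis .
  qed
  have L0: "0 \<le> ?L T1" by (simp add: loss_eq_norm_entry_mask)
  have main: "?L t \<le> ?L T1 * exp (- (1/2) * \<sigma>min\<^sup>2 * (t - T1)) \<and> norm (A t - A T1) \<le> ?\<delta>"
    if t: "T1 \<le> t" for t
  \<comment> \<open>If \<open>\<sigma>min\<close> is 0, the smallness assumption forces zero loss at
    \<open>T1\<close>; so \<open>\<sigma>min\<close> is positive whenever the loss is not 0.\<close>
  proof (cases "?L T1 = 0")
    case True
    then show ?thesis
      using gradient_flow_on_stationary[OF assms(4) t True] \<delta> by simp
  next
    case False
    then have s: "0 < \<sigma>min"
      using assms(8) L0 s0 by (cases "\<sigma>min = 0") auto
    interpret conditioned_flow Wstar ?\<Omega> T1 \<sigma>min A B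
      using assms(4) s cond by unfold_locales
    \<comment> \<open>Since 1152 = 8 * 144, this radius turns the smallness assumption, with
      \<open>\<sigma>max\<close> weakened to \<open>\<sigma>min\<close>, into the hypothesis of
      \<open>stays_near\<close>. It is below \<open>?\<delta>\<close> because 4 sqrt 2 is less than
      12.\<close>
    define \<delta>' where "\<delta>' = \<sigma>min / (12 * sqrt ?d)"
    have \<delta>': "0 < \<delta>'" "\<delta>' < \<sigma>min / 2" "\<delta>' \<le> ?\<delta>"
    proof -
      show "0 < \<delta>'" using s d by (simp add: \<delta>'_def)
      have "\<delta>' \<le> \<sigma>min / (12 * 1)"
        unfolding \<delta>'_def using s d by (intro divide_left_mono) auto
      then show "\<delta>' < \<sigma>min / 2" using s by simp
      have "4 * sqrt (2 * ?d) \<le> 12 * sqrt ?d"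
        using d sqrt2_less_2 by (simp add: real_sqrt_mult)
      then show "\<delta>' \<le> ?\<delta>"
        unfolding \<delta>'_def using s d by (intro divide_left_mono) auto
    qed
    have "\<sigma>min ^ 6 / (1152 * ?d * \<sigma>max\<^sup>2) \<le> \<sigma>min ^ 6 / (1152 * ?d * \<sigma>min\<^sup>2)"
      using s d minmax by (intro divide_left_mono mult_left_mono power_mono) auto
    also have "\<dots> = \<sigma>min\<^sup>2 * \<delta>'\<^sup>2 / 8"
    proof -
      have "\<sigma>min ^ 6 = \<sigma>min\<^sup>2 * \<sigma>min\<^sup>2 * \<sigma>min\<^sup>2"
        by (simp flip: power_add)
      moreover have "\<delta>'\<^sup>2 = \<sigma>min\<^sup>2 / (144 * ?d)"
        by (simp add: \<delta>'_def power_divide power_mult_distrib)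
      moreover have "x * x * x / (1152 * y * x) = x * (x / (144 * y)) / 8" if "x \<noteq> 0" for x y :: real
        using that by simp
      ultimately show ?thesis
        using s by (metis power_not_zero less_numeral_extra(3))
    qed
    finally have small: "L T1 \<le> \<sigma>min\<^sup>2 * \<delta>'\<^sup>2 / 8"
      using assms(8) by (simp add: L_def)
    note near = stays_near[OF \<delta>'(1,2) small]
    have "norm (A t - A T1) \<le> norm ((A t, B t) - (A T1, B T1))"
      using norm_fst_le[of "A t - A T1" "B t - B T1"] by simp
    also have "\<dots> \<le> ?\<delta>"
      using near[OF t] \<delta>'(3) by simp
    moreover have "L t \<le> L T1 * exp (- (1/2) * \<sigma>min\<^sup>2 * (t - T1))"
    proof (rule exponential_decay[OF _ t])
      show "norm ((A u, B u) - (A T1, B T1)) \<le> \<sigma>min / 2" if "T1 < u" for u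
        using near[of u] \<delta>'(2) that by simp
    qed
    ultimately show ?thesis by (simp add: L_def)
  qed
  show ?thesis
  proof (intro conjI allI impI)
    fix t assume t: "T1 \<le> t"
    show "?L t \<le> ?L T1 * exp (- (1/2) * \<sigma>min\<^sup>2 * (t - T1))"
      using main[OF t] by (rule conjunct1)
    show "srank (A t) = srank (B t)"
      using balanced_same_norms(3)[OF bal[OF t]] .
    show "((norm (A T1) - ?\<delta>) / (spectral_norm (A T1) + ?\<delta>))\<^sup>2 \<le> srank (A t)"
      using main[OF t] by (intro srank_perturbation \<delta> \<delta>_le) (rule conjunct2)
  qed
qed

end
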